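(* Let $N\ge2$, $\Omega=\{1,\dots,N\}$, and let $(w_m)_{m\in\Omega}$ be positive numbers forming a log-concave sequence, i.e., $w_{m-1}w_{m+1}\le w_m^2$ for $2\le m\le N-1$. Let $P$ be the transition matrix on $\Omega$ given by $P(i,j)=\frac14\min\{1,w_j/w_i\}$ if $|i-j|=1$, $P(i,j)=0$ if $|i-j|>1$, and $P(i,i)=1-P(i,i-1)-P(i,i+1)$ (with nonexistent terms omitted). Then $$\frac{1}{\mathrm{gap}(P)}\le 4|\Omega|^3\max_{i,j\in\Omega:\,|i-j|=1}\frac{w_i}{w_j}.$$
   Context: The chain $P$ is reversible with stationary distribution $\pi(i)=w_i/\sum_{p}w_p$ and has real eigenvalues $1=\lambda_0>\lambda_1\ge\cdots$; $\mathrm{gap}(P)=1-\lambda_1$. *)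

theory Defs
  imports
    "HOL-Library.Multiset"
    "Jordan_Normal_Form.Char_Poly"
begin

definition metropolis_step :: "(nat \<Rightarrow> real) \<Rightarrow> nat \<Rightarrow> nat \<Rightarrow> real" where
  "metropolis_step w i j = 1/4 * min 1 (w j / w i)"

text \<open>
  The entries are indexed by the state space \<open>{1..N}\<close>. In the diagonal entry, the
  guards drop the terms of the missing neighbours \<open>0\<close> of \<open>1\<close> and \<open>N + 1\<close> of \<open>N\<close>.
\<close>

definition metropolis :: "nat \<Rightarrow> (nat \<Rightarrow> real) \<Rightarrow> nat \<Rightarrow> nat \<Rightarrow> real" where
  "metropolis N w i j =
    (if i = j then
       1 - (if 1 < i then metropolis_step w i (i - 1) else 0)
         - (if i < N then metropolis_step w i (i + 1) else 0)
     else if \<bar>int i - int j\<bar> = 1 then metropolis_step w i j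
     else 0)"

text \<open>Matrix indices start at \<open>0\<close>, so row and column \<open>k\<close> belong to the state \<open>k + 1\<close>.\<close>

definition metropolis_mat :: "nat \<Rightarrow> (nat \<Rightarrow> real) \<Rightarrow> real mat" where
  "metropolis_mat N w = mat N N (\<lambda>(i, j). metropolis N w (i + 1) (j + 1))"

text \<open>
  The real eigenvalues \<open>\<lambda>\<^sub>0 \<ge> \<lambda>\<^sub>1 \<ge> \<dots>\<close>, each repeated according to its multiplicity as a
  root of the characteristic polynomial. For a reversible transition matrix all eigenvalues
  are real, so the list has as many entries as the matrix has rows.
\<close>

definition eigenvalues_desc :: "real mat \<Rightarrow> real list" where
  "eigenvalues_desc A = rev (sorted_list_of_multiset (proots (char_poly A)))"

definition spectral_gap :: "real mat \<Rightarrow> real" where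
  "spectral_gap A = 1 - eigenvalues_desc A ! 1"

end

theory Submission
  imports
    Defs
    "Jordan_Normal_Form.Schur_Decomposition"
    "HOL-Analysis.Convex"
begin

text \<open>
  Log-concavity enters only through unimodality: \<open>min (w i) (w j) \<le> w k\<close> for \<open>k\<close> between \<open>i\<close> and
  \<open>j\<close>. Hence \<open>w i * w j \<le> (w i + w j) * min (w k) (w (k + 1))\<close> for every edge of the path from \<open>i\<close>
  to \<open>j\<close>, and summing the Cauchy-Schwarz bound for \<open>(f i - f j)\<^sup>2\<close> along these paths over all pairs
  yields a Poincare inequality with constant \<open>4 * N\<^sup>2\<close>, independent of the ratios of the weights.
  Since the largest ratio of neighbouring weights is at least \<open>1\<close>, this is stronger than claimed.

  To read off the second largest root of the characteristic polynomial with multiplicities,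
  reversibility makes all roots real, and a Schur triangularization with the roots in decreasing
  order provides a vector \<open>v\<close>, independent of the constants, whose image is \<open>\<lambda>\<^sub>1 v\<close> plus a constant.
  The Poincare inequality for \<open>v\<close> minus its mean gives the bound on \<open>1 - \<lambda>\<^sub>1\<close>.
\<close>

section \<open>Splitting of the characteristic polynomial over the reals\<close>

text \<open>Over the complex numbers the splitting always exists. Its roots are eigenvalues, hence
  real, and the embedding of real polynomials is injective, so the factorization descends.\<close>

lemma char_poly_splits_over_reals:
  fixes A :: "real mat"
  assumes A: "A \<in> carrier_mat n n"
    and real_ev: "\<And>a. eigenvalue (map_mat complex_of_real A) a \<Longrightarrow> Im a = 0"
  obtains es where "char_poly A = (\<Prod>e\<leftarrow>es. [:- e, 1:])" "length es = n"
proof -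
  let ?C = "map_mat complex_of_real A"
  have C: "?C \<in> carrier_mat n n" using A by simp
  obtain as where as: "char_poly ?C = (\<Prod>a\<leftarrow>as. [:- a, 1:])" and len: "length as = n"
    using char_poly_factorized[OF C] by blast
  have im: "Im a = 0" if "a \<in> set as" for a
  proof -
    have "poly (char_poly ?C) a = 0"
      using that unfolding as by (auto simp: poly_prod_list prod_list_zero_iff image_iff)
    then show ?thesis using real_ev eigenvalue_root_char_poly[OF C] by blast
  qed
  interpret of_real_poly: map_poly_inj_idom_hom complex_of_real ..
  define es where "es = map Re as"
  have "map_poly complex_of_real (\<Prod>e\<leftarrow>es. [:- e, 1:])
      = (\<Prod>e\<leftarrow>es. map_poly complex_of_real [:- e, 1:])"
    by (simp add: of_real_poly.hom_prod_list o_def)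
  also have "\<dots> = (\<Prod>a\<leftarrow>as. [:- a, 1:])"
    unfolding es_def map_map o_def
    by (intro arg_cong[where f = prod_list] map_cong) (auto simp: im complex_eq_iff)
  also have "\<dots> = map_poly complex_of_real (char_poly A)"
    unfolding as[symmetric] by (rule of_real_hom.char_poly_hom[OF A])
  finally have "char_poly A = (\<Prod>e\<leftarrow>es. [:- e, 1:])" by simp
  then show ?thesis using that[of es] len by (simp add: es_def)
qed

text \<open>\<open>proots\<close> turns products into multiset sums and each linear factor
  contributes one root, so every splitting lists the same roots up to order.\<close>

lemma eigenvalues_desc_of_splitting:
  assumes "char_poly A = (\<Prod>e\<leftarrow>es. [:- e, 1:])"
  shows "mset (eigenvalues_desc A) = mset es"
    "char_poly A = (\<Prod>e\<leftarrow>eigenvalues_desc A. [:- e, 1:])"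
proof -
  have "proots (char_poly A) = (\<Sum>p\<leftarrow>map (\<lambda>e. [:- e, 1:]) es. proots p)"
    unfolding assms by (subst proots_prod_list[symmetric]) auto
  also have "\<dots> = mset es" by (induction es) auto
  finally show mset: "mset (eigenvalues_desc A) = mset es"
    by (simp add: eigenvalues_desc_def)
  have "(\<Prod>e\<leftarrow>eigenvalues_desc A. [:- e, 1:]) = (\<Prod>e\<in>#mset (eigenvalues_desc A). [:- e, 1:])"
    by (metis mset_map prod_mset_prod_list)
  also have "\<dots> = char_poly A"
    unfolding mset assms by (metis mset_map prod_mset_prod_list)
  finally show "char_poly A = (\<Prod>e\<leftarrow>eigenvalues_desc A. [:- e, 1:])" by simp
qed

section \<open>Spectral theory of reversible matrices\<close>

text \<open>\<open>u\<close> is the stationary distribution without normalization. Detailed balance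
  says that \<open>A\<close> is self-adjoint for the inner product with weights
  \<open>u\<close>.\<close>

locale reversible_mat =
  fixes n :: nat and A :: "real mat" and u :: "nat \<Rightarrow> real"
  assumes carrier: "A \<in> carrier_mat n n"
    and pos: "i < n \<Longrightarrow> 0 < u i"
    and reversible: "i < n \<Longrightarrow> j < n \<Longrightarrow> u i * A $$ (i, j) = u j * A $$ (j, i)"
    and row_sum: "i < n \<Longrightarrow> (\<Sum>j<n. A $$ (i, j)) = 1"
begin

definition act :: "(nat \<Rightarrow> real) \<Rightarrow> nat \<Rightarrow> real" where
  "act x i = (\<Sum>j<n. A $$ (i, j) * x j)"

lemma act_self_adjoint: "(\<Sum>i<n. u i * (y i * act x i)) = (\<Sum>i<n. u i * (act y i * x i))"
proof -
  have "(\<Sum>i<n. u i * (y i * act x i)) = (\<Sum>i<n. \<Sum>j<n. (u i * A $$ (i, j)) * (y i * x j))"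
    by (simp add: act_def sum_distrib_left mult_ac)
  also have "\<dots> = (\<Sum>i<n. \<Sum>j<n. (u j * A $$ (j, i)) * (y i * x j))"
    by (intro sum.cong refl) (simp add: reversible)
  also have "\<dots> = (\<Sum>j<n. \<Sum>i<n. (u j * A $$ (j, i)) * (y i * x j))"
    by (rule sum.swap)
  also have "\<dots> = (\<Sum>i<n. u i * (act y i * x i))"
    by (simp add: act_def sum_distrib_left sum_distrib_right mult_ac)
  finally show ?thesis .
qed

lemma act_const: "i < n \<Longrightarrow> act (\<lambda>_. k) i = k"
  by (simp add: act_def row_sum flip: sum_distrib_right)

lemma act_minus: "act (\<lambda>i. x i - y i) i = act x i - act y i"
  by (simp add: act_def algebra_simps sum_subtractf)

text \<open>Stationarity of \<open>u\<close>: self-adjointness is applied against the constant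
  function \<open>1\<close>, which \<open>act\<close> fixes.\<close>

lemma act_mean: "(\<Sum>i<n. u i * act x i) = (\<Sum>i<n. u i * x i)"
proof -
  have "(\<Sum>i<n. u i * act x i) = (\<Sum>i<n. u i * (1 * act x i))" by simp
  also have "\<dots> = (\<Sum>i<n. u i * (act (\<lambda>_. 1) i * x i))"
    by (rule act_self_adjoint)
  also have "\<dots> = (\<Sum>i<n. u i * x i)" by (simp add: act_const)
  finally show ?thesis .
qed

lemma norm_pos:
  assumes "i < n" "x i \<noteq> 0"
  shows "0 < (\<Sum>i<n. u i * (x i)\<^sup>2)"
proof (rule sum_pos2[of _ i])
  show "0 < u i * (x i)\<^sup>2" using assms pos[of i] by simp
  show "0 \<le> u j * (x j)\<^sup>2" if "j \<in> {..<n}" for j using that pos[of j] by simp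
qed (use assms in simp_all)

lemma complex_eigenvalue_real:
  assumes "eigenvalue (map_mat complex_of_real A) a"
  shows "Im a = 0"
proof -
  obtain v where v: "v \<in> carrier_vec n" "v \<noteq> 0\<^sub>v n" "map_mat complex_of_real A *\<^sub>v v = a \<cdot>\<^sub>v v"
    using assms carrier unfolding eigenvalue_def eigenvector_def by auto
  define x y where "x = (\<lambda>i. Re (v $ i))" and "y = (\<lambda>i. Im (v $ i))"
  have eq: "(\<Sum>j<n. complex_of_real (A $$ (i, j)) * v $ j) = a * v $ i" if "i < n" for i
  proof -
    have "(map_mat complex_of_real A *\<^sub>v v) $ i = (a \<cdot>\<^sub>v v) $ i" using v(3) by simp
    then show ?thesis
      using that carrier v(1) by (simp add: scalar_prod_def lessThan_atLeast0)
  qed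
  have x: "act x i = Re a * x i - Im a * y i" and y: "act y i = Re a * y i + Im a * x i"
    if "i < n" for i
    using arg_cong[OF eq[OF that], of Re] arg_cong[OF eq[OF that], of Im]
    by (simp_all add: act_def x_def y_def)
  \<comment> \<open>Pairing the imaginary part with the image of the real part cancels all terms
    with \<open>Re a\<close> and leaves \<open>Im a\<close> times the squared norm of
    \<open>v\<close>.\<close>
  have "(\<Sum>i<n. u i * (y i * (Re a * x i - Im a * y i)))
      = (\<Sum>i<n. u i * ((Re a * y i + Im a * x i) * x i))"
    using act_self_adjoint[of y x] by (simp add: x y)
  then have "0 = (\<Sum>i<n. u i * ((Re a * y i + Im a * x i) * x i)
      - u i * (y i * (Re a * x i - Im a * y i)))"
    by (simp add: sum_subtractf)
  also have "\<dots> = (\<Sum>i<n. Im a * (u i * (x i)\<^sup>2 + u i * (y i)\<^sup>2))"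
    by (intro sum.cong refl) (simp add: algebra_simps power2_eq_square)
  also have "\<dots> = Im a * ((\<Sum>i<n. u i * (x i)\<^sup>2) + (\<Sum>i<n. u i * (y i)\<^sup>2))"
    by (simp add: sum.distrib flip: sum_distrib_left)
  finally have prod: "Im a * ((\<Sum>i<n. u i * (x i)\<^sup>2) + (\<Sum>i<n. u i * (y i)\<^sup>2)) = 0" by simp
  obtain i where i: "i < n" "v $ i \<noteq> 0" using v(1,2) by (metis carrier_vecD eq_vecI index_zero_vec)
  have nonneg: "0 \<le> (\<Sum>i<n. u i * (x i)\<^sup>2)" "0 \<le> (\<Sum>i<n. u i * (y i)\<^sup>2)"
    using pos by (auto intro!: sum_nonneg simp: less_imp_le)
  have "x i \<noteq> 0 \<or> y i \<noteq> 0" using i(2) by (auto simp: x_def y_def complex_eq_iff)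
  then have "0 < (\<Sum>i<n. u i * (x i)\<^sup>2) + (\<Sum>i<n. u i * (y i)\<^sup>2)"
    using norm_pos[of i x] norm_pos[of i y] i(1) nonneg by linarith
  with prod show ?thesis by simp
qed

lemma eigenvalues_desc_splits:
  "char_poly A = (\<Prod>e\<leftarrow>eigenvalues_desc A. [:- e, 1:])" "length (eigenvalues_desc A) = n"
proof -
  obtain es where es: "char_poly A = (\<Prod>e\<leftarrow>es. [:- e, 1:])" "length es = n"
    using char_poly_splits_over_reals[OF carrier complex_eigenvalue_real] by blast
  show "char_poly A = (\<Prod>e\<leftarrow>eigenvalues_desc A. [:- e, 1:])"
    by (rule eigenvalues_desc_of_splitting[OF es(1)])
  show "length (eigenvalues_desc A) = n"
    using eigenvalues_desc_of_splitting(1)[OF es(1)] es(2) by (metis size_mset)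
qed

text \<open>
  The additive constant \<open>k\<close> covers generalized eigenvectors above the constant vector, so that
  the bound also excludes a second Jordan direction for the eigenvalue \<open>1\<close>.
\<close>

lemma poincare_imp_eigenvalue_bound:
  assumes poincare: "\<And>x. (\<Sum>i<n. u i * x i) = 0 \<Longrightarrow>
      c * (\<Sum>i<n. u i * (x i)\<^sup>2) \<le> (\<Sum>i<n. u i * (x i * (x i - act x i)))"
    and x: "\<And>i. i < n \<Longrightarrow> act x i = l * x i + k"
    and nonconst: "i < n" "j < n" "x i \<noteq> x j"
  shows "c \<le> 1 - l"
proof -
  define U where "U = (\<Sum>i<n. u i)"
  have U: "U > 0"
    unfolding U_def using nonconst(1) pos by (intro sum_pos) auto
  \<comment> \<open>Subtracting the weighted mean \<open>m\<close> makes the Poincare inequality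
    applicable; \<open>k'\<close> is the additive constant after this shift.\<close>
  define m where "m = (\<Sum>i<n. u i * x i) / U"
  define y where "y = (\<lambda>i. x i - m)"
  define k' where "k' = k + l * m - m"
  have mean: "(\<Sum>i<n. u i * y i) = 0"
  proof -
    have "(\<Sum>i<n. u i * y i) = (\<Sum>i<n. u i * x i) - U * m"
      by (simp add: y_def right_diff_distrib sum_subtractf U_def sum_distrib_right)
    then show ?thesis using U by (simp add: m_def)
  qed
  have act_y: "act y i = l * y i + k'" if "i < n" for i
    using x[OF that] act_const[OF that, of m]
    by (simp add: y_def act_minus k'_def algebra_simps)
  \<comment> \<open>Since \<open>act\<close> preserves the weighted mean, \<open>k'\<close> must
    vanish and \<open>y\<close> is a genuine eigenfunction for \<open>l\<close>.\<close>
  have "0 = (\<Sum>i<n. u i * act y i)" using act_mean[of y] mean by simp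
  also have "\<dots> = (\<Sum>i<n. l * (u i * y i) + k' * u i)"
    by (intro sum.cong refl) (simp add: act_y algebra_simps)
  also have "\<dots> = k' * U" using mean by (simp add: sum.distrib U_def flip: sum_distrib_left)
  finally have "k' = 0" using U by simp
  then have "(\<Sum>i<n. u i * (y i * (y i - act y i))) = (\<Sum>i<n. (1 - l) * (u i * (y i)\<^sup>2))"
    by (intro sum.cong refl) (simp add: act_y algebra_simps power2_eq_square)
  then have le: "c * (\<Sum>i<n. u i * (y i)\<^sup>2) \<le> (1 - l) * (\<Sum>i<n. u i * (y i)\<^sup>2)"
    using poincare[OF mean] by (simp add: sum_distrib_left)
  have "y i \<noteq> 0 \<or> y j \<noteq> 0" using nonconst(3) by (auto simp: y_def)
  then have "0 < (\<Sum>i<n. u i * (y i)\<^sup>2)" using norm_pos nonconst by blast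
  with le show ?thesis by simp
qed

text \<open>The bound for nonconstant functions is applied to the first two columns of the Schur
  basis \<open>P\<close>. It forces column 0 to be constant, and then invertibility of
  \<open>P\<close> makes column 1 nonconstant.\<close>

theorem poincare_imp_spectral_gap:
  assumes n: "n \<ge> 2" and c: "c > 0"
    and poincare: "\<And>x. (\<Sum>i<n. u i * x i) = 0 \<Longrightarrow>
      c * (\<Sum>i<n. u i * (x i)\<^sup>2) \<le> (\<Sum>i<n. u i * (x i * (x i - act x i)))"
  shows "c \<le> spectral_gap A"
proof -
  define es where "es = eigenvalues_desc A"
  have cp: "char_poly A = (\<Prod>e\<leftarrow>es. [:- e, 1:])" and len: "length es = n"
    using eigenvalues_desc_splits by (simp_all add: es_def)
  have root: "eigenvalue A e \<longleftrightarrow> e \<in> set es" for e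
    unfolding eigenvalue_root_char_poly[OF carrier] cp
    by (auto simp: poly_prod_list prod_list_zero_iff image_iff)
  \<comment> \<open>A constant eigenvector has eigenvalue \<open>1\<close>; a nonconstant one has
    eigenvalue at most \<open>1 - c\<close>.\<close>
  have le_1: "e \<le> 1" if e: "e \<in> set es" for e
  proof -
    obtain v where v: "v \<in> carrier_vec n" "v \<noteq> 0\<^sub>v n" "A *\<^sub>v v = e \<cdot>\<^sub>v v"
      using e root carrier unfolding eigenvalue_def eigenvector_def by auto
    have act_v: "act (\<lambda>i. v $ i) i = e * v $ i" if "i < n" for i
    proof -
      have "(A *\<^sub>v v) $ i = (e \<cdot>\<^sub>v v) $ i" using v(3) by simp
      then show ?thesis
        using that carrier v(1) by (simp add: act_def scalar_prod_def lessThan_atLeast0)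
    qed
    obtain i where i: "i < n" "v $ i \<noteq> 0"
      using v(1,2) by (metis carrier_vecD eq_vecI index_zero_vec)
    show ?thesis
    proof (cases "\<forall>j<n. v $ j = v $ i")
      case True
      then have "act (\<lambda>i. v $ i) i = act (\<lambda>_. v $ i) i" by (simp add: act_def)
      then show ?thesis using act_v act_const i by simp
    next
      case False
      then obtain j where j: "j < n" "v $ j \<noteq> v $ i" by blast
      have "c \<le> 1 - e"
        by (rule poincare_imp_eigenvalue_bound[where x = "\<lambda>i. v $ i" and k = 0, OF poincare _ j(1) i(1) j(2)])
          (simp_all add: act_v)
      then show ?thesis using c by simp
    qed
  qed
  have "eigenvector A (vec n (\<lambda>_. 1)) 1"
    using carrier n row_sum
    by (auto simp: eigenvector_def scalar_prod_def lessThan_atLeast0 vec_eq_iff intro: exI[of _ 0])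
  then have "1 \<in> set es" using root by (auto simp: eigenvalue_def)
  then obtain p where p: "p < n" "es ! p = 1" using len by (metis in_set_conv_nth)
  have "sorted (rev es)" by (simp add: es_def eigenvalues_desc_def)
  then have "es ! p \<le> es ! 0" using p(1) len by (intro sorted_rev_nth_mono) auto
  moreover have "es ! 0 \<in> set es" using len n by (intro nth_mem) auto
  ultimately have es0: "es ! 0 = 1" using p(2) le_1 by fastforce

  \<comment> \<open>The decomposition keeps the prescribed order of the roots on the diagonal, so
    columns 0 and 1 of \<open>P\<close> belong to the two largest.\<close>
  obtain B P Q where dec: "schur_decomposition A es = (B, P, Q)"
    by (cases "schur_decomposition A es")
  then have sim: "similar_mat_wit A B P Q" and upper: "upper_triangular B" and diag: "diag_mat B = es"
    using schur_decomposition[OF carrier cp] by blast+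
  note D = similar_mat_witD2[OF carrier sim]
  have diag_B: "B $$ (i, i) = es ! i" if "i < n" for i
    using that D(5) diag by (auto simp: diag_mat_def)
  have "A * P = P * B"
  proof -
    have "A * P = P * B * Q * P" unfolding D(3)[symmetric] ..
    also have "\<dots> = P * B * (Q * P)" using D(5-7) by (intro assoc_mult_mat) auto
    also have "\<dots> = P * B" using D(2,5,6) by simp
    finally show ?thesis .
  qed
  then have AP: "act (\<lambda>k. P $$ (k, j)) i = (\<Sum>k<n. P $$ (i, k) * B $$ (k, j))"
    if "i < n" "j < n" for i j
  proof -
    have "(A * P) $$ (i, j) = (P * B) $$ (i, j)" using \<open>A * P = P * B\<close> by simp
    then show ?thesis
      using that carrier D(5,6) by (simp add: act_def scalar_prod_def lessThan_atLeast0)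
  qed
  have QP: "(\<Sum>k<n. Q $$ (i, k) * P $$ (k, j)) = (if i = j then 1 else 0)"
    if "i < n" "j < n" for i j
  proof -
    have "(Q * P) $$ (i, j) = (1\<^sub>m n :: real mat) $$ (i, j)" using D(2) by simp
    then show ?thesis
      using that D(6,7) by (simp add: scalar_prod_def lessThan_atLeast0)
  qed
  have B_below: "B $$ (k, j) = 0" if "j < k" "k < n" for k j
    using upper that D(5) by (auto simp: upper_triangular_def)
  have col0: "act (\<lambda>k. P $$ (k, 0)) i = 1 * P $$ (i, 0) + 0" if "i < n" for i
  proof -
    have "(\<Sum>k<n. P $$ (i, k) * B $$ (k, 0)) = (\<Sum>k\<in>{0}. P $$ (i, k) * B $$ (k, 0))"
      using n by (intro sum.mono_neutral_right) (auto simp: B_below)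
    then show ?thesis using AP[OF that, of 0] n diag_B[of 0] es0 by simp
  qed
  define a where "a = P $$ (0, 0)"
  have const0: "P $$ (i, 0) = a" if "i < n" for i
  proof (rule ccontr)
    assume "P $$ (i, 0) \<noteq> a"
    \<comment> \<open>Column 0 is an eigenvector for \<open>1\<close>; were it nonconstant, the
      bound would contradict \<open>c > 0\<close>.\<close>
    with that n have "c \<le> 1 - 1"
      by (intro poincare_imp_eigenvalue_bound[OF poincare col0, of i 0]) (simp_all add: a_def)
    with c show False by simp
  qed
  \<comment> \<open>The entry of \<open>B\<close> above the diagonal multiplies the constant column
    0, so it only adds a constant.\<close>
  have col1: "act (\<lambda>k. P $$ (k, 1)) i = es ! 1 * P $$ (i, 1) + a * B $$ (0, 1)" if "i < n" for i
  proof -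
    have "(\<Sum>k<n. P $$ (i, k) * B $$ (k, 1)) = (\<Sum>k\<in>{0, 1}. P $$ (i, k) * B $$ (k, 1))"
      using n by (intro sum.mono_neutral_right) (auto simp: B_below)
    then show ?thesis using AP[OF that, of 1] n diag_B[of 1] const0[OF that] by simp
  qed
  have "\<exists>i<n. P $$ (i, 1) \<noteq> P $$ (0, 1)"
  proof (rule ccontr)
    assume "\<not> ?thesis"
    then obtain d where const1: "\<And>i. i < n \<Longrightarrow> P $$ (i, 1) = d" by blast
    \<comment> \<open>With both columns constant, \<open>Q * P = 1\<close> gives
      \<open>a \<noteq> 0\<close>, so row 1 of \<open>Q\<close> sums to zero, against the third
      equation.\<close>
    have "(\<Sum>k<n. Q $$ (0, k)) * a = 1" "(\<Sum>k<n. Q $$ (1, k)) * a = 0"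
      "(\<Sum>k<n. Q $$ (1, k)) * d = 1"
      using QP[of 0 0] QP[of 1 0] QP[of 1 1] n
      by (simp_all add: const0 const1[simplified] sum_distrib_right)
    then show False by auto
  qed
  then obtain i where "i < n" "P $$ (i, 1) \<noteq> P $$ (0, 1)" by blast
  with n have "c \<le> 1 - es ! 1"
    by (intro poincare_imp_eigenvalue_bound[OF poincare col1, of i 0]) simp_all
  then show ?thesis by (simp add: spectral_gap_def es_def)
qed

end

section \<open>Poincare inequality for unimodal weights on a path\<close>

lemma path_diff_square_le:
  fixes f :: "nat \<Rightarrow> real"
  assumes "i \<le> j"
  shows "(f j - f i)\<^sup>2 \<le> real (j - i) * (\<Sum>k=i..<j. (f (Suc k) - f k)\<^sup>2)"
proof -
  have "f j - f i = (\<Sum>k=i..<j. f (Suc k) - f k)" using assms by (simp add: sum_Suc_diff')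
  then show ?thesis
    using sum_squared_le_sum_of_squares[of "\<lambda>k. f (Suc k) - f k" "{i..<j}"]
    by (simp add: mult.commute)
qed

text \<open>Ratios of successive terms do not increase, so after one strict descent the sequence
  keeps descending. A value at \<open>k\<close> below the one at \<open>i\<close> requires a descent
  before \<open>k\<close>, which puts the value at \<open>j\<close> below that at \<open>k\<close>
  too.\<close>

lemma log_concave_unimodal:
  fixes u :: "nat \<Rightarrow> real"
  assumes pos: "\<And>i. i < n \<Longrightarrow> 0 < u i"
    and concave: "\<And>i. Suc (Suc i) < n \<Longrightarrow> u i * u (Suc (Suc i)) \<le> (u (Suc i))\<^sup>2"
    and "i \<le> k" "k \<le> j" "j < n"
  shows "min (u i) (u j) \<le> u k"
proof (rule ccontr)
  assume less: "\<not> ?thesis"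
  have "\<exists>l\<ge>i. l < k \<and> u (Suc l) < u l"
  proof (rule ccontr)
    assume "\<not> ?thesis"
    then have "u l \<le> u (Suc l)" if "i \<le> l" "l < k" for l using that by force
    with \<open>i \<le> k\<close> have "u i \<le> u k" by (induction k rule: dec_induct) force+
    with less show False by simp
  qed
  then obtain l where l: "l < k" "u (Suc l) < u l" by blast
  have dec: "Suc m < n \<longrightarrow> u (Suc m) < u m" if "l \<le> m" for m
    using that
  proof (induction m rule: dec_induct)
    case (step m)
    show ?case
    proof
      assume m: "Suc (Suc m) < n"
      then have IH: "u (Suc m) < u m" using step by simp
      have "u m * u (Suc (Suc m)) \<le> u (Suc m) * u (Suc m)"
        using concave[OF m] by (simp add: power2_eq_square)
      also have "\<dots> < u m * u (Suc m)" using IH pos m by (intro mult_strict_right_mono) auto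
      finally show "u (Suc (Suc m)) < u (Suc m)" using pos[of m] m by simp
    qed
  qed (use l in simp)
  from \<open>k \<le> j\<close> \<open>j < n\<close> have "u j \<le> u k"
  proof (induction j rule: dec_induct)
    case (step m)
    then show ?case using dec[of m] l by auto
  qed simp
  with less show False by simp
qed

text \<open>One factor \<open>n\<close> bounds the length of the path between two points, the other
  comes from summing over all pairs.\<close>

lemma unimodal_poincare:
  fixes u f :: "nat \<Rightarrow> real"
  assumes pos: "\<And>i. i < n \<Longrightarrow> 0 < u i"
    and unimodal: "\<And>i j k. i \<le> k \<Longrightarrow> k \<le> j \<Longrightarrow> j < n \<Longrightarrow> min (u i) (u j) \<le> u k"
    and mean: "(\<Sum>i<n. u i * f i) = 0"
  shows "(\<Sum>i<n. u i * (f i)\<^sup>2)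
    \<le> (real n)\<^sup>2 * (\<Sum>k<n - 1. min (u k) (u (Suc k)) * (f (Suc k) - f k)\<^sup>2)"
    (is "?V \<le> (real n)\<^sup>2 * ?D")
proof (cases "n = 0")
  case False
  define U where "U = (\<Sum>i<n. u i)"
  have U: "U > 0" unfolding U_def using False pos by (intro sum_pos) auto
  have D: "?D \<ge> 0" using pos by (intro sum_nonneg mult_nonneg_nonneg) (auto simp: less_imp_le)
  have ordered: "u i * u j * (f j - f i)\<^sup>2 \<le> (u i + u j) * (real n * ?D)"
    if ij: "i \<le> j" "j < n" for i j
  proof -
    have u: "0 < u i" "0 < u j" using pos ij by auto
    have "min (u i) (u j) * (f j - f i)\<^sup>2
        \<le> min (u i) (u j) * (real n * (\<Sum>k=i..<j. (f (Suc k) - f k)\<^sup>2))"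
    proof (intro mult_left_mono)
      have "(f j - f i)\<^sup>2 \<le> real (j - i) * (\<Sum>k=i..<j. (f (Suc k) - f k)\<^sup>2)"
        by (rule path_diff_square_le[OF ij(1)])
      also have "\<dots> \<le> real n * (\<Sum>k=i..<j. (f (Suc k) - f k)\<^sup>2)"
        using ij by (intro mult_right_mono sum_nonneg) auto
      finally show "(f j - f i)\<^sup>2 \<le> real n * (\<Sum>k=i..<j. (f (Suc k) - f k)\<^sup>2)" .
    qed (use u in simp)
    also have "\<dots> = real n * (\<Sum>k=i..<j. min (u i) (u j) * (f (Suc k) - f k)\<^sup>2)"
      by (simp add: sum_distrib_left mult_ac)
    also have "\<dots> \<le> real n * (\<Sum>k=i..<j. min (u k) (u (Suc k)) * (f (Suc k) - f k)\<^sup>2)"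
    proof (intro mult_left_mono sum_mono mult_right_mono)
      fix k assume "k \<in> {i..<j}"
      then show "min (u i) (u j) \<le> min (u k) (u (Suc k))"
        using unimodal[of i k j] unimodal[of i "Suc k" j] ij by simp
    qed auto
    also have "\<dots> \<le> real n * ?D"
      using ij pos
      by (intro mult_left_mono sum_mono2 mult_nonneg_nonneg) (auto simp: less_imp_le)
    finally have "min (u i) (u j) * (f j - f i)\<^sup>2 \<le> real n * ?D" .
    \<comment> \<open>The product \<open>u i * u j\<close> is maximum times minimum: the minimum is
      absorbed by the edge weights, the maximum by \<open>u i + u j\<close>.\<close>
    then have "max (u i) (u j) * (min (u i) (u j) * (f j - f i)\<^sup>2)
        \<le> max (u i) (u j) * (real n * ?D)"
      using u by (intro mult_left_mono) auto
    also have "\<dots> \<le> (u i + u j) * (real n * ?D)"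
      using u D by (intro mult_right_mono) auto
    finally show ?thesis by (auto simp: max_def min_def mult_ac split: if_splits)
  qed
  have pair: "u i * u j * (f j - f i)\<^sup>2 \<le> (u i + u j) * (real n * ?D)"
    if "i < n" "j < n" for i j
    using ordered[of i j] ordered[of j i] that
    by (cases "i \<le> j") (simp_all add: add.commute mult.commute power2_commute)
  \<comment> \<open>The variance as a sum over ordered pairs; the mean-zero assumption removes the
    cross term.\<close>
  have "2 * U * ?V = (\<Sum>i<n. \<Sum>j<n. u i * u j * (f j - f i)\<^sup>2)"
  proof -
    have "(\<Sum>i<n. \<Sum>j<n. u i * u j * (f j - f i)\<^sup>2)
      = (\<Sum>i<n. \<Sum>j<n. u i * (u j * (f j)\<^sup>2) + (u i * (f i)\<^sup>2) * u j - 2 * ((u i * f i) * (u j * f j)))"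
      by (intro sum.cong refl) (simp add: power2_eq_square algebra_simps)
    also have "\<dots> = U * ?V + ?V * U - 2 * ((\<Sum>i<n. u i * f i) * (\<Sum>j<n. u j * f j))"
      by (simp add: sum.distrib sum_subtractf U_def flip: sum_distrib_left sum_distrib_right)
    finally show ?thesis using mean by simp
  qed
  also have "\<dots> \<le> (\<Sum>i<n. \<Sum>j<n. (u i + u j) * (real n * ?D))"
    by (intro sum_mono pair) auto
  also have "\<dots> = (\<Sum>i<n. \<Sum>j<n. u i + u j) * (real n * ?D)"
    unfolding sum_distrib_right ..
  also have "(\<Sum>i<n. \<Sum>j<n. u i + u j) = 2 * real n * U"
    by (simp add: sum.distrib U_def flip: sum_distrib_left)
  finally have "2 * U * ?V \<le> 2 * U * ((real n)\<^sup>2 * ?D)"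
    by (simp add: power2_eq_square mult_ac)
  then show ?thesis using U by simp
qed simp

section \<open>Dirichlet form of the Metropolis chain\<close>

lemma sum_by_parts:
  fixes x g :: "nat \<Rightarrow> 'a::comm_ring_1"
  shows "(\<Sum>i<n. x i * (g (Suc i) - g i))
    = x n * g n - x 0 * g 0 - (\<Sum>i<n. (x (Suc i) - x i) * g (Suc i))"
  by (induction n) (simp_all add: algebra_simps)

text \<open>The right-hand side is symmetric in \<open>i\<close> and \<open>j\<close>, which is
  detailed balance; it is also the conductance of the edge.\<close>

lemma step_balance:
  assumes "0 < w i" "0 < w j"
  shows "w i * metropolis_step w i j = min (w i) (w j) / 4"
  using assms by (auto simp: metropolis_step_def min_def field_simps)

lemma metropolis_sum:
  fixes x :: "nat \<Rightarrow> real"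
  assumes "i < N"
  shows "(\<Sum>j<N. metropolis N w (Suc i) (Suc j) * x j) = x i
    + (if 0 < i then metropolis_step w (Suc i) i * (x (i - 1) - x i) else 0)
    + (if Suc i < N then metropolis_step w (Suc i) (Suc (Suc i)) * (x (Suc i) - x i) else 0)"
proof -
  let ?a = "if 0 < i then metropolis_step w (Suc i) i else 0"
  let ?b = "if Suc i < N then metropolis_step w (Suc i) (Suc (Suc i)) else 0"
  \<comment> \<open>For \<open>i = 0\<close> the truncated \<open>i - 1\<close> equals
    \<open>i\<close>, but then \<open>?a = 0\<close>, so the overlapping cases add nothing.\<close>
  have "metropolis N w (Suc i) (Suc j) * x j = (if j = i then (1 - ?a - ?b) * x i else 0)
      + (if j = i - 1 then ?a * x (i - 1) else 0) + (if j = Suc i then ?b * x (Suc i) else 0)"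
    if "j < N" for j
    using that assms by (auto simp: metropolis_def)
  then have "(\<Sum>j<N. metropolis N w (Suc i) (Suc j) * x j)
      = (\<Sum>j<N. (if j = i then (1 - ?a - ?b) * x i else 0)
      + (if j = i - 1 then ?a * x (i - 1) else 0) + (if j = Suc i then ?b * x (Suc i) else 0))"
    by (intro sum.cong) auto
  also have "\<dots> = (1 - ?a - ?b) * x i + ?a * x (i - 1) + ?b * x (Suc i)"
    using assms by (simp add: sum.distrib)
  finally show ?thesis
    by (cases "0 < i"; cases "Suc i < N") (simp_all add: algebra_simps)
qed

lemma reversible_metropolis:
  assumes w_pos: "\<And>m. m \<in> {1..N} \<Longrightarrow> w m > 0"
  shows "reversible_mat N (metropolis_mat N w) (\<lambda>i. w (Suc i))"
proof
  show "metropolis_mat N w \<in> carrier_mat N N" by (simp add: metropolis_mat_def)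
  show "0 < w (Suc i)" if "i < N" for i using w_pos that by simp
  show "w (Suc i) * metropolis_mat N w $$ (i, j) = w (Suc j) * metropolis_mat N w $$ (j, i)"
    if "i < N" "j < N" for i j
  proof -
    have "w (Suc i) * metropolis_step w (Suc i) (Suc j) = w (Suc j) * metropolis_step w (Suc j) (Suc i)"
      using step_balance[of w "Suc i" "Suc j"] step_balance[of w "Suc j" "Suc i"] w_pos that
      by (simp add: min.commute)
    then show ?thesis using that by (auto simp: metropolis_mat_def metropolis_def)
  qed
  show "(\<Sum>j<N. metropolis_mat N w $$ (i, j)) = 1" if "i < N" for i
    using metropolis_sum[OF that, of w "\<lambda>_. 1"] that by (simp add: metropolis_mat_def)
qed

text \<open>A discrete Green formula: the generator is the divergence of an edge flux, and summation
  by parts moves the difference onto \<open>x\<close>. The \<open>4\<close> is the one in the step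
  probability.\<close>

lemma metropolis_dirichlet:
  fixes x :: "nat \<Rightarrow> real"
  assumes w_pos: "\<And>m. m \<in> {1..N} \<Longrightarrow> w m > 0"
  shows "(\<Sum>i<N. w (Suc i) * (x i * (x i - reversible_mat.act N (metropolis_mat N w) x i)))
    = (\<Sum>k<N - 1. min (w (Suc k)) (w (Suc (Suc k))) * (x (Suc k) - x k)\<^sup>2) / 4"
proof (cases "N = 0")
  case False
  interpret reversible_mat N "metropolis_mat N w" "\<lambda>i. w (Suc i)"
    by (rule reversible_metropolis[OF w_pos])
  \<comment> \<open>Up to the factor \<open>1/4\<close>, \<open>g i\<close> is the flux across the
    edge between the states \<open>i\<close> and \<open>i + 1\<close>. Setting it to zero at
    \<open>0\<close> and \<open>N\<close> encodes the missing neighbours and removes the boundary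
    terms.\<close>
  define g where
    "g i = (if i = 0 \<or> i = N then 0 else min (w i) (w (Suc i)) * (x i - x (i - 1)))" for i
  have local: "w (Suc i) * (x i * (x i - act x i)) = - (x i * (g (Suc i) - g i)) / 4"
    if i: "i < N" for i
  proof -
    have act: "act x i = x i
        + (if 0 < i then metropolis_step w (Suc i) i * (x (i - 1) - x i) else 0)
        + (if Suc i < N then metropolis_step w (Suc i) (Suc (Suc i)) * (x (Suc i) - x i) else 0)"
      unfolding metropolis_sum[OF i, symmetric] act_def
      using i by (intro sum.cong refl) (simp add: metropolis_mat_def)
    have "w (Suc i) * (act x i - x i)
        = (if 0 < i then w (Suc i) * metropolis_step w (Suc i) i * (x (i - 1) - x i) else 0)
        + (if Suc i < N then w (Suc i) * metropolis_step w (Suc i) (Suc (Suc i)) * (x (Suc i) - x i) else 0)"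
      unfolding act by (simp add: algebra_simps)
    also have "\<dots> = (if 0 < i then min (w i) (w (Suc i)) / 4 * (x (i - 1) - x i) else 0)
        + (if Suc i < N then min (w (Suc i)) (w (Suc (Suc i))) / 4 * (x (Suc i) - x i) else 0)"
    proof -
      have "w (Suc i) * metropolis_step w (Suc i) i = min (w i) (w (Suc i)) / 4" if "0 < i"
        using step_balance[of w "Suc i" i] w_pos[of i] w_pos[of "Suc i"] that i
        by (simp add: min.commute)
      moreover have "w (Suc i) * metropolis_step w (Suc i) (Suc (Suc i))
          = min (w (Suc i)) (w (Suc (Suc i))) / 4" if "Suc i < N"
        using step_balance[of w "Suc i" "Suc (Suc i)"] w_pos that by simp
      ultimately show ?thesis by (auto simp only: split: if_split)
    qed
    also have "\<dots> = (g (Suc i) - g i) / 4"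
      using i by (auto simp: g_def field_simps)
    finally have flux: "w (Suc i) * (act x i - x i) = (g (Suc i) - g i) / 4" .
    have "w (Suc i) * (x i * (x i - act x i)) = - (x i * (w (Suc i) * (act x i - x i)))"
      by (simp add: algebra_simps)
    then show ?thesis unfolding flux by simp
  qed
  have "(\<Sum>i<N. w (Suc i) * (x i * (x i - act x i))) = - (\<Sum>i<N. x i * (g (Suc i) - g i)) / 4"
    by (simp add: local sum_negf flip: sum_divide_distrib)
  also have "\<dots> = (\<Sum>i<N. (x (Suc i) - x i) * g (Suc i)) / 4"
    unfolding sum_by_parts by (simp add: g_def)
  also have "(\<Sum>i<N. (x (Suc i) - x i) * g (Suc i)) = (\<Sum>i<N - 1. (x (Suc i) - x i) * g (Suc i))"
    using False by (cases N) (simp_all add: g_def)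
  also have "\<dots> = (\<Sum>k<N - 1. min (w (Suc k)) (w (Suc (Suc k))) * (x (Suc k) - x k)\<^sup>2)"
    by (intro sum.cong refl) (auto simp: g_def power2_eq_square)
  finally show ?thesis .
qed simp

text \<open>The constant combines \<open>N\<close> squared from the Poincare inequality with the
  \<open>1/4\<close> in the Dirichlet form.\<close>

theorem metropolis_spectral_gap:
  assumes N: "N \<ge> 2"
    and w_pos: "\<And>m. m \<in> {1..N} \<Longrightarrow> w m > 0"
    and concave: "\<And>m. 2 \<le> m \<Longrightarrow> m \<le> N - 1 \<Longrightarrow> w (m - 1) * w (m + 1) \<le> (w m)\<^sup>2"
  shows "1 / (4 * (real N)\<^sup>2) \<le> spectral_gap (metropolis_mat N w)"
proof -
  interpret reversible_mat N "metropolis_mat N w" "\<lambda>i. w (Suc i)"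
    by (rule reversible_metropolis[OF w_pos])
  have unimodal: "min (w (Suc i)) (w (Suc j)) \<le> w (Suc k)" if "i \<le> k" "k \<le> j" "j < N" for i j k
  proof (rule log_concave_unimodal[where u = "\<lambda>i. w (Suc i)", OF _ _ that])
    show "0 < w (Suc i)" if "i < N" for i using w_pos that by simp
    show "w (Suc i) * w (Suc (Suc (Suc i))) \<le> (w (Suc (Suc i)))\<^sup>2" if "Suc (Suc i) < N" for i
      using concave[of "Suc (Suc i)"] that by simp
  qed
  show ?thesis
  proof (rule poincare_imp_spectral_gap[OF N])
    show "0 < 1 / (4 * (real N)\<^sup>2)" using N by simp
  next
    fix x assume mean: "(\<Sum>i<N. w (Suc i) * x i) = 0"
    have "(\<Sum>i<N. w (Suc i) * (x i)\<^sup>2)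
        \<le> (real N)\<^sup>2 * (\<Sum>k<N - 1. min (w (Suc k)) (w (Suc (Suc k))) * (x (Suc k) - x k)\<^sup>2)"
      by (rule unimodal_poincare[OF _ unimodal mean]) (use w_pos in auto)
    then have "1 / (4 * (real N)\<^sup>2) * (\<Sum>i<N. w (Suc i) * (x i)\<^sup>2)
        \<le> 1 / (4 * (real N)\<^sup>2) * ((real N)\<^sup>2
          * (\<Sum>k<N - 1. min (w (Suc k)) (w (Suc (Suc k))) * (x (Suc k) - x k)\<^sup>2))"
      by (rule mult_left_mono) simp
    also have "\<dots> = (\<Sum>i<N. w (Suc i) * (x i * (x i - act x i)))"
      using N metropolis_dirichlet[of N w x, OF w_pos] by simp
    finally show "1 / (4 * (real N)\<^sup>2) * (\<Sum>i<N. w (Suc i) * (x i)\<^sup>2)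
        \<le> (\<Sum>i<N. w (Suc i) * (x i * (x i - act x i)))" .
  qed
qed

section \<open>Comparison with the largest neighbouring ratio\<close>

text \<open>The set contains a ratio together with its reciprocal, and one of the two is at least
  \<open>1\<close>.\<close>

lemma one_le_Max_adjacent_ratio:
  fixes w :: "nat \<Rightarrow> real"
  assumes N: "N \<ge> 2" and pos: "\<And>m. m \<in> {1..N} \<Longrightarrow> w m > 0"
  shows "1 \<le> Max {w i / w j | i j. i \<in> {1..N} \<and> j \<in> {1..N} \<and> \<bar>int i - int j\<bar> = 1}"
    (is "1 \<le> Max ?R")
proof -
  have "?R \<subseteq> (\<lambda>(i, j). w i / w j) ` ({1..N} \<times> {1..N})" by auto
  then have fin: "finite ?R" by (rule finite_subset) simp
  have "w 1 / w 2 \<in> ?R" using N by (intro CollectI exI[of _ 1] exI[of _ 2]) auto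
  moreover have "w 2 / w 1 \<in> ?R" using N by (intro CollectI exI[of _ 2] exI[of _ 1]) auto
  moreover have "1 \<le> w 1 / w 2 \<or> 1 \<le> w 2 / w 1"
    using pos[of 1] pos[of 2] N by (auto simp: field_simps)
  ultimately show ?thesis using Max_ge[OF fin] by (meson order_trans)
qed

text \<open>Positivity of the gap is part of the conclusion because the bound on the reciprocal
  alone would also hold for a zero or negative gap, division by zero giving
  \<open>0\<close>.\<close>

theorem theorem5p5:
  fixes N :: nat and w :: "nat \<Rightarrow> real"
  assumes "N \<ge> 2"
    and "\<And>m. m \<in> {1..N} \<Longrightarrow> w m > 0"
    and "\<And>m. 2 \<le> m \<Longrightarrow> m \<le> N - 1 \<Longrightarrow> w (m - 1) * w (m + 1) \<le> (w m)\<^sup>2"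
  shows "spectral_gap (metropolis_mat N w) > 0 \<and>
    1 / spectral_gap (metropolis_mat N w)
      \<le> 4 * real (card {1..N}) ^ 3 *
         Max {w i / w j | i j. i \<in> {1..N} \<and> j \<in> {1..N} \<and> \<bar>int i - int j\<bar> = 1}"
    (is "?g > 0 \<and> 1 / ?g \<le> 4 * _ * ?M")
proof
  have gap: "1 / (4 * (real N)\<^sup>2) \<le> ?g" by (rule metropolis_spectral_gap[OF assms])
  have "0 < 1 / (4 * (real N)\<^sup>2)" using assms(1) by simp
  with gap show pos: "?g > 0" by linarith
  have "1 / ?g \<le> 4 * (real N)\<^sup>2"
    using gap pos assms(1) by (simp add: field_simps)
  also have "\<dots> \<le> 4 * real N ^ 3 * 1"
    using assms(1) by (simp add: power_increasing)
  also have "\<dots> \<le> 4 * real N ^ 3 * ?M"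
    by (intro mult_left_mono one_le_Max_adjacent_ratio assms) auto
  finally show "1 / ?g \<le> 4 * real (card {1..N}) ^ 3 * ?M" by simp
qed

end
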